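(* Define $g(t,k)$ for integers $t\ge 0$ and $k\ge 2$ by $g(t,2)=g(0,k)=1$ for all $t\ge 0$ and $k\ge 2$, and inductively $g(t,k)=\lceil (t+1)/2\rceil+g(\lfloor (t-1)/2\rfloor,k-1)$ for $t\ge 1$ and $k\ge 3$. Then for all integers $t\ge 0$ and $k\ge 2$, there exists a $K_k$-free graph of tree-width at most $t$ with chromatic number at least $g(t,k)$.
   Context: Graphs are finite and simple. A graph is $K_k$-free if it does not contain the complete graph $K_k$ on $k$ vertices as a subgraph. A tree decomposition of a graph $G$ is a pair $(T,\beta)$, where $T$ is a tree and $\beta$ is a function assigning to each vertex of $T$ a set of vertices of $G$, such that for every $uv\in E(G)$ there exists $z\in V(T)$ with $\{u,v\}\subseteq\beta(z)$, and such that for every $v\in V(G)$, the set $\{z\in V(T):v\in\beta(z)\}$ induces a non-empty connected subtree of $T$. The width of the decomposition is the maximum of $|\beta(z)|-1$ over all $z\in V(T)$, and the tree-width of $G$ is the minimum possible width of a tree decomposition of $G$. *)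

theory Defs
  imports Complex_Main "Graph_Theory.Graph_Theory"
begin

text \<open>
  A finite simple graph is a \<^locale>\<open>pair_graph\<close>: a finite vertex set with a symmetric irreflexive
  arc relation, the edge \<open>uv\<close> being the pair of arcs \<open>(u, v)\<close>, \<open>(v, u)\<close>.
\<close>

definition clique_free :: "nat \<Rightarrow> 'a pair_pre_digraph \<Rightarrow> bool" where
  "clique_free k G \<longleftrightarrow> (\<nexists>H. subgraph H (with_proj G) \<and> complete_digraph k H)"

text \<open>
  The library's \<^const>\<open>tree\<close> does not fit here: it counts the closed walk \<open>u, v, u\<close> as a cycle, so
  no symmetric digraph with an edge satisfies it.  The cycles of a simple graph are the library's
  cycles of length at least 3.  \<^const>\<open>Digraph_Component.connected\<close> includes non-emptiness.
\<close>

definition simple_tree :: "'a pair_pre_digraph \<Rightarrow> bool" where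
  "simple_tree T \<longleftrightarrow> pair_graph T \<and> Digraph_Component.connected (with_proj T) \<and>
     (\<nexists>p. pre_digraph.cycle (with_proj T) p \<and> length p \<ge> 3)"

text \<open>
  Since the induced subgraph of a tree is a forest, it is a subtree iff it is connected.
\<close>

definition tree_decomposition ::
  "'a pair_pre_digraph \<Rightarrow> 'n pair_pre_digraph \<Rightarrow> ('n \<Rightarrow> 'a set) \<Rightarrow> bool" where
  "tree_decomposition G T \<beta> \<longleftrightarrow>
     simple_tree T \<and>
     (\<forall>z\<in>pverts T. \<beta> z \<subseteq> pverts G) \<and>
     (\<forall>(u, v)\<in>parcs G. \<exists>z\<in>pverts T. {u, v} \<subseteq> \<beta> z) \<and>
     (\<forall>v\<in>pverts G. Digraph_Component.connected (with_proj T \<restriction> {z \<in> pverts T. v \<in> \<beta> z}))"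

text \<open>Integer-valued, as the graph without vertices has width \<open>-1\<close>.\<close>

definition decomposition_width :: "'n pair_pre_digraph \<Rightarrow> ('n \<Rightarrow> 'a set) \<Rightarrow> int" where
  "decomposition_width T \<beta> = Max ((\<lambda>z. int (card (\<beta> z)) - 1) ` pverts T)"

text \<open>
  Trees being finite, it is no restriction to take natural numbers as their vertices.  The minimum
  exists: one bag containing all vertices is a decomposition, and every width is at least \<open>-1\<close>.
\<close>

definition treewidth :: "'a pair_pre_digraph \<Rightarrow> int" where
  "treewidth G = (LEAST w. \<exists>(T :: nat pair_pre_digraph) \<beta>.
     tree_decomposition G T \<beta> \<and> w = decomposition_width T \<beta>)"

definition proper_colouring :: "'a pair_pre_digraph \<Rightarrow> ('a \<Rightarrow> 'c) \<Rightarrow> bool" where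
  "proper_colouring G c \<longleftrightarrow> (\<forall>(u, v)\<in>parcs G. c u \<noteq> c v)"

definition chromatic_number :: "'a pair_pre_digraph \<Rightarrow> nat" where
  "chromatic_number G =
     (LEAST n. \<exists>c :: 'a \<Rightarrow> nat. c ` pverts G \<subseteq> {..<n} \<and> proper_colouring G c)"

text \<open>Only the values for \<open>k \<ge> 2\<close> are meaningful.\<close>

fun g :: "nat \<Rightarrow> nat \<Rightarrow> nat" where
  "g t k = (if t = 0 \<or> k \<le> 2 then 1
     else nat \<lceil>(real t + 1) / 2\<rceil> + g (nat \<lfloor>(real t - 1) / 2\<rfloor>) (k - 1))"

declare g.simps [simp del]

end

(*
  Presenter reveals vertices one at a time to Colourer, keeping a bag of at most t old vertices to which
  the new one may be joined, and joining it to no clique of size k - 1.  The graph whose vertices are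
  all plays of bounded length is K_k-free, and the tree of plays yields a decomposition of width at
  most t; a proper colouring of it is a strategy for Colourer.  So it suffices that Presenter can force
  g(t, k) colours.  He first builds, in a bag of size t, an independent set of t div 2 + 1 vertices with
  distinct colours.  Then he joins all later vertices to this set and plays recursively with
  parameters (t - 1) div 2 and k - 1 in the room that is left in the bag.
*)

theory Submission
  imports Defs "HOL-Library.Sublist"
begin

section \<open>Tree decompositions from rooted trees\<close>

text \<open>The strictly decreasing \<open>rank\<close> makes climbing along \<open>par\<close> end
  at \<open>r\<close>. It serves both as induction measure for connectivity and, by looking at a
  vertex of largest rank, to exclude cycles.\<close>

locale rooted_tree =
  fixes V :: "'n set" and r :: 'n and par :: "'n \<Rightarrow> 'n" and rank :: "'n \<Rightarrow> nat"
  assumes finite_V: "finite V"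
    and root_in: "r \<in> V"
    and par_in: "x \<in> V \<Longrightarrow> x \<noteq> r \<Longrightarrow> par x \<in> V"
    and rank_par: "x \<in> V \<Longrightarrow> x \<noteq> r \<Longrightarrow> rank (par x) < rank x"
begin

definition parent_tree :: "'n pair_pre_digraph" where
  "parent_tree = \<lparr>pverts = V,
     parcs = {(x, y). x \<in> V \<and> y \<in> V \<and> (x \<noteq> r \<and> y = par x \<or> y \<noteq> r \<and> x = par y)}\<rparr>"

lemma pverts_parent_tree [simp]: "pverts parent_tree = V"
  by (simp add: parent_tree_def)

lemma parcs_parent_tree_iff:
  "(x, y) \<in> parcs parent_tree \<longleftrightarrow>
     x \<in> V \<and> y \<in> V \<and> (x \<noteq> r \<and> y = par x \<or> y \<noteq> r \<and> x = par y)"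
  by (simp add: parent_tree_def)

lemma pair_graph_parent_tree: "pair_graph parent_tree"
proof
  show "finite (pverts parent_tree)" using finite_V by simp
  show "finite (parcs parent_tree)"
    by (rule finite_subset[of _ "V \<times> V"]) (auto simp: parent_tree_def finite_V)
  show "symmetric (with_proj parent_tree)"
    by (auto simp: symmetric_def sym_def parcs_parent_tree_iff)
next
  fix e assume "e \<in> parcs parent_tree"
  then show "fst e \<in> pverts parent_tree" "snd e \<in> pverts parent_tree" "fst e \<noteq> snd e"
    by (cases e; use rank_par in \<open>force simp: parcs_parent_tree_iff\<close>)+
qed

text \<open>Climbing from any element of \<open>X\<close> stays inside \<open>X\<close> until it
  meets \<open>v\<close>, so every element is linked to \<open>v\<close>, and through
  \<open>v\<close> to every other one.\<close>

lemma connected_parent_tree_induce: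
  assumes X: "X \<subseteq> V" "v \<in> X"
    and up: "\<And>x. x \<in> X \<Longrightarrow> x \<noteq> v \<Longrightarrow> x \<noteq> r \<and> par x \<in> X"
  shows "Digraph_Component.connected (with_proj parent_tree \<restriction> X)"
proof -
  \<comment> \<open>\<open>connected\<close> means strongly connected after symmetric closure, so
    reachability is studied in this closure.\<close>
  let ?M = "mk_symmetric (with_proj parent_tree \<restriction> X)"
  have arc: "(x, y) \<in> parcs ?M" if "x \<in> X" "y \<in> X" "(x, y) \<in> parcs parent_tree" for x y
    using that by (force simp: parcs_mk_symmetric induce_subgraph_def)
  interpret T: pair_graph parent_tree by (rule pair_graph_parent_tree)
  have "wf_digraph (with_proj parent_tree \<restriction> X)"
    by (simp add: wf_digraph_def induce_subgraph_def)
  then interpret M: pair_wf_digraph ?M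
    by (rule wf_digraph.wellformed_mk_symmetric)
  have sym: "symmetric (with_proj ?M)"
    by (rule symmetric_mk_symmetric)
  have reach: "x \<rightarrow>\<^sup>*\<^bsub>with_proj ?M\<^esub> v" if "x \<in> X" for x
    using that
  proof (induction "rank x" arbitrary: x rule: less_induct)
    case less
    show ?case
    proof (cases "x = v")
      case True
      then show ?thesis using X by simp
    next
      case False
      then have *: "x \<noteq> r" "par x \<in> X" using up less.prems by auto
      moreover have xV: "x \<in> V" using less.prems X by auto
      ultimately have "par x \<rightarrow>\<^sup>*\<^bsub>with_proj ?M\<^esub> v"
        by (intro less.hyps rank_par)
      moreover have "(x, par x) \<in> parcs ?M"
        using * less.prems xV X by (intro arc) (auto simp: parcs_parent_tree_iff)
      ultimately show ?thesis
        using M.adj_reachable_trans by simp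
    qed
  qed
  show ?thesis
    unfolding Digraph_Component.connected_def
  proof (rule strongly_connectedI)
    show "verts (with_proj ?M) \<noteq> {}" using X by auto
    fix u w assume "u \<in> verts (with_proj ?M)" "w \<in> verts (with_proj ?M)"
    then have "u \<rightarrow>\<^sup>*\<^bsub>with_proj ?M\<^esub> v" "v \<rightarrow>\<^sup>*\<^bsub>with_proj ?M\<^esub> w"
      using reach symmetric_reachable[OF sym] by auto
    then show "u \<rightarrow>\<^sup>*\<^bsub>with_proj ?M\<^esub> w" by (rule M.reachable_trans)
  qed
qed

lemma pcas_nth:
  assumes "pcas u p v" "Suc i < length p"
  shows "fst (p ! Suc i) = snd (p ! i)"
  using assms
proof (induction p arbitrary: u i)
  case (Cons e p)
  then show ?case by (cases i; cases p) auto
qed simp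

lemma pcas_ends:
  assumes "pcas u p v" "p \<noteq> []"
  shows "fst (p ! 0) = u" "snd (p ! (length p - 1)) = v"
  using assms
proof (induction p arbitrary: u)
  case (Cons e p)
  { case 1 then show ?case by simp }
  { case 2 then show ?case using Cons.IH by (cases p) auto }
qed simp_all

text \<open>On a cycle, both neighbours of a vertex of largest rank would be its parent.\<close>

lemma no_cycle_parent_tree:
  assumes cyc: "pre_digraph.cycle (with_proj parent_tree) p" and len: "length p \<ge> 3"
  shows False
proof -
  let ?n = "length p"
  interpret T: pair_graph parent_tree by (rule pair_graph_parent_tree)
  obtain u where walk: "T.awalk u p u" and dist: "distinct (tl (pawalk_verts u p))"
    using cyc by (auto simp: T.cycle_def)
  have cas: "pcas u p u" and arcs: "set p \<subseteq> parcs parent_tree"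
    using walk by (auto simp: T.awalk_def)
  have "p \<noteq> []" using len by auto
  then have "tl (pawalk_verts u p) = map snd p"
    using T.awalk_verts_conv'[OF cas] by simp
  then have dist: "distinct (map snd p)" using dist by simp
  have succ: "fst (p ! (Suc i mod ?n)) = snd (p ! i)" if "i < ?n" for i
  proof (cases "Suc i < ?n")
    case True
    then show ?thesis using pcas_nth[OF cas] by simp
  next
    case False
    then have "Suc i = ?n" using that by simp
    then show ?thesis using pcas_ends[OF cas \<open>p \<noteq> []\<close>] by (metis diff_Suc_1 mod_self)
  qed
  define R where "R = (\<lambda>i. rank (snd (p ! i))) ` {..<?n}"
  have "Max R \<in> R" unfolding R_def using \<open>p \<noteq> []\<close> by (intro Max_in) auto
  then obtain j where j: "j < ?n" "rank (snd (p ! j)) = Max R" by (auto simp: R_def)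
  then have jmax: "rank (snd (p ! i)) \<le> rank (snd (p ! j))" if "i < ?n" for i
    using that by (auto simp: R_def)
  \<comment> \<open>Cyclically, arc \<open>i\<close> precedes arc \<open>j\<close> and arc
    \<open>l\<close> follows it: arc \<open>j\<close> enters the top vertex \<open>?x\<close> from
    the head of arc \<open>i\<close>, and arc \<open>l\<close> leaves \<open>?x\<close>.\<close>
  define i where "i = (if j = 0 then ?n - 1 else j - 1)"
  have i: "i < ?n" "Suc i mod ?n = j" using j by (auto simp: i_def)
  define l where "l = Suc j mod ?n"
  have l: "l < ?n" using \<open>p \<noteq> []\<close> by (simp add: l_def)
  have arc: "p ! m \<in> parcs parent_tree" if "m < ?n" for m
    using arcs that nth_mem by blast
  \<comment> \<open>The other orientation, \<open>x = par a\<close>, would make the rank of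
    \<open>x\<close> smaller than that of \<open>a\<close>.\<close>
  have par: "a = par x" if "(a, x) \<in> parcs parent_tree" "rank a \<le> rank x" for a x
    using that rank_par[of a] by (auto simp: parcs_parent_tree_iff)
  let ?x = "snd (p ! j)"
  have "p ! j = (snd (p ! i), ?x)" using succ[OF i(1)] i(2) by (simp add: prod_eq_iff)
  then have a: "snd (p ! i) = par ?x"
    using arc[OF j(1)] jmax[OF i(1)] par by metis
  have "p ! l = (?x, snd (p ! l))" using succ[OF j(1)] by (simp add: prod_eq_iff l_def)
  then have "(snd (p ! l), ?x) \<in> parcs parent_tree"
    using arc[OF l] by (metis T.arcs_symmetric)
  then have "snd (p ! l) = par ?x" using jmax[OF l] par by blast
  \<comment> \<open>The heads on a cycle are distinct, so equal heads mean equal arcs. Predecessor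
    and successor of \<open>j\<close> can coincide only if the length is at most 2.\<close>
  then have "i = l"
    using a dist i(1) l by (metis length_map nth_eq_iff_index_eq nth_map)
  then show False using i(1) j len
    by (auto simp: i_def l_def mod_Suc split: if_splits)
qed

lemma simple_tree_parent_tree: "simple_tree parent_tree"
proof -
  have "with_proj parent_tree \<restriction> V = with_proj parent_tree"
    by (auto simp: induce_subgraph_def with_proj_def parent_tree_def)
  moreover have "Digraph_Component.connected (with_proj parent_tree \<restriction> V)"
    using root_in par_in by (intro connected_parent_tree_induce[of _ r]) auto
  ultimately show ?thesis
    using pair_graph_parent_tree no_cycle_parent_tree by (auto simp: simple_tree_def)
qed

text \<open>Every vertex of \<open>G\<close> is its own tree node. By \<open>up\<close>, a node
  whose bag contains \<open>v\<close> passes \<open>v\<close> on to its parent unless it is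
  \<open>v\<close> itself, so these nodes form a subtree with top \<open>v\<close>.\<close>

lemma tree_decomposition_parent_tree:
  assumes G: "pverts G = V" "\<And>u v. (u, v) \<in> parcs G \<Longrightarrow> u \<in> V \<and> v \<in> V \<and> (u \<in> \<beta> v \<or> v \<in> \<beta> u)"
    and \<beta>: "\<And>x. x \<in> V \<Longrightarrow> x \<in> \<beta> x \<and> \<beta> x \<subseteq> V"
    and up: "\<And>x v. x \<in> V \<Longrightarrow> v \<in> \<beta> x \<Longrightarrow> x \<noteq> v \<Longrightarrow> x \<noteq> r \<and> v \<in> \<beta> (par x)"
  shows "tree_decomposition G parent_tree \<beta>"
  unfolding tree_decomposition_def
proof (intro conjI ballI)
  show "simple_tree parent_tree" by (rule simple_tree_parent_tree)
  show "\<beta> z \<subseteq> pverts G" if "z \<in> pverts parent_tree" for z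
    using that \<beta> G by auto
  show "case e of (u, v) \<Rightarrow> \<exists>z\<in>pverts parent_tree. {u, v} \<subseteq> \<beta> z" if "e \<in> parcs G" for e
    using that \<beta> G(2) by (cases e) fastforce
  show "Digraph_Component.connected (with_proj parent_tree \<restriction> {z \<in> pverts parent_tree. v \<in> \<beta> z})"
    if "v \<in> pverts G" for v
  proof (rule connected_parent_tree_induce)
    have v: "v \<in> V" using that G by simp
    show "{z \<in> pverts parent_tree. v \<in> \<beta> z} \<subseteq> V" by auto
    show "v \<in> {z \<in> pverts parent_tree. v \<in> \<beta> z}" using \<beta> v by simp
    fix x assume "x \<in> {z \<in> pverts parent_tree. v \<in> \<beta> z}" "x \<noteq> v"
    then have "x \<in> V" "x \<noteq> r \<and> v \<in> \<beta> (par x)" using up by auto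
    then show "x \<noteq> r \<and> par x \<in> {z \<in> pverts parent_tree. v \<in> \<beta> z}" using par_in by auto
  qed
qed

end

lemma treewidth_le:
  fixes T :: "nat pair_pre_digraph"
  assumes T: "tree_decomposition G T \<beta>" and w: "\<And>z. z \<in> pverts T \<Longrightarrow> card (\<beta> z) \<le> Suc w"
  shows "treewidth G \<le> int w"
proof -
  let ?P = "\<lambda>x. \<exists>(T :: nat pair_pre_digraph) \<beta>.
     tree_decomposition G T \<beta> \<and> x = decomposition_width T \<beta>"
  have fin: "finite (pverts T) \<and> pverts T \<noteq> {}" if "tree_decomposition G T \<beta>"
    for T :: "nat pair_pre_digraph" and \<beta>
    using that
    by (auto simp: tree_decomposition_def simple_tree_def pair_graph_def pair_digraph_def
        pair_fin_digraph_def pair_fin_digraph_axioms_def Digraph_Component.connected_def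
        strongly_connected_def)
  have lower: "x \<ge> -1" if "?P x" for x
  proof -
    from that obtain T :: "nat pair_pre_digraph" and \<beta>
      where T: "tree_decomposition G T \<beta>" "x = decomposition_width T \<beta>"
      by blast
    obtain z where "z \<in> pverts T" using fin[OF T(1)] by auto
    then have "int (card (\<beta> z)) - 1 \<le> x"
      using fin[OF T(1)] by (auto simp: T(2) decomposition_width_def intro!: Max_ge)
    then show ?thesis by linarith
  qed
  have least: "(LEAST x. ?P x) \<le> x" if "?P x" for x
  proof -
    \<comment> \<open>The integers are not well-ordered, so \<open>LEAST\<close> needs a proof that
      a minimum exists. Widths are at least -1, and adding 1 moves the question to the natural
      numbers.\<close>
    define n where "n = (LEAST n :: nat. ?P (int n - 1))"
    have ex: "?P (int (nat (y + 1)) - 1) \<and> int (nat (y + 1)) - 1 = y" if "?P y" for y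
      using lower[OF that] that by simp
    have "?P (int n - 1)" unfolding n_def by (rule LeastI[of "\<lambda>n. ?P (int n - 1)"]) (use ex[OF that] in blast)
    moreover have min: "int n - 1 \<le> y" if "?P y" for y
      using Least_le[of "\<lambda>n. ?P (int n - 1)", OF conjunct1[OF ex[OF that]]] ex[OF that]
      unfolding n_def by linarith
    ultimately have "(LEAST x. ?P x) = int n - 1" by (rule Least_equality)
    then show ?thesis using min[OF that] by simp
  qed
  have "treewidth G \<le> decomposition_width T \<beta>"
    unfolding treewidth_def by (rule least) (use T in auto)
  also have "\<dots> \<le> int w"
    unfolding decomposition_width_def
    using fin[OF T] w by (subst Max_le_iff) (auto simp: le_diff_eq, force)
  finally show ?thesis .
qed

section \<open>Plays\<close>

type_synonym move = "nat set \<times> nat set"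

text \<open>This is the bag after \<open>h\<close>: the newest vertex, whose index is
  \<open>length h - 1\<close>, and what its move kept. It may have \<open>t + 1\<close> elements, of
  which the next move keeps at most \<open>t\<close>.\<close>

definition available :: "move list \<Rightarrow> nat set" where
  "available h = (if h = [] then {} else insert (length h - 1) (fst (last h)))"

text \<open>Testing pairs with \<open>i < j\<close> is enough because in a play each move names only
  earlier vertices as neighbours.\<close>

definition clique :: "move list \<Rightarrow> nat set \<Rightarrow> bool" where
  "clique h K \<longleftrightarrow> (\<forall>i\<in>K. \<forall>j\<in>K. i < j \<longrightarrow> i \<in> snd (h ! j))"

definition indep_set :: "move list \<Rightarrow> nat set \<Rightarrow> bool" where
  "indep_set h S \<longleftrightarrow> (\<forall>i\<in>S. \<forall>j\<in>S. i \<notin> snd (h ! j))"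

text \<open>
  The \<open>i\<close>-th move presents vertex \<open>i\<close>: the vertices of its first component stay in the bag, and
  those of the second one become its neighbours.
\<close>

inductive play :: "nat \<Rightarrow> nat \<Rightarrow> move list \<Rightarrow> bool" for t k where
  Nil: "play t k []"
| snoc: "play t k h \<Longrightarrow> N \<subseteq> B \<Longrightarrow> B \<subseteq> available h \<Longrightarrow> card B \<le> t \<Longrightarrow>
    (\<And>K. K \<subseteq> N \<Longrightarrow> clique h K \<Longrightarrow> card K + 2 \<le> k) \<Longrightarrow> play t k (h @ [(B, N)])"

lemma play_snoc_iff:
  "play t k (h @ [m]) \<longleftrightarrow> play t k h \<and> snd m \<subseteq> fst m \<and> fst m \<subseteq> available h \<and> card (fst m) \<le> t \<and>
     (\<forall>K. K \<subseteq> snd m \<longrightarrow> clique h K \<longrightarrow> card K + 2 \<le> k)"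
proof
  show "play t k (h @ [m]) \<Longrightarrow> play t k h \<and> snd m \<subseteq> fst m \<and> fst m \<subseteq> available h \<and> card (fst m) \<le> t \<and>
     (\<forall>K. K \<subseteq> snd m \<longrightarrow> clique h K \<longrightarrow> card K + 2 \<le> k)"
    by (erule play.cases) auto
qed (cases m, auto intro: play.snoc)

lemma play_append: "play t k (h @ h') \<Longrightarrow> play t k h"
  by (induction h' rule: rev_induct) (auto simp: play_snoc_iff simp flip: append_assoc)

lemma play_take: "play t k h \<Longrightarrow> play t k (take n h)"
  by (metis append_take_drop_id play_append)

lemma available_snoc [simp]: "available (h @ [m]) = insert (length h) (fst m)"
  by (simp add: available_def)

lemma available_less: "play t k h \<Longrightarrow> available h \<subseteq> {..<length h}"
proof (induction rule: play.induct)
  case (snoc h N B)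
  then show ?case by (fastforce simp: less_Suc_eq)
qed (simp add: available_def)

lemma play_nth:
  assumes "play t k h" "j < length h"
  shows "snd (h ! j) \<subseteq> fst (h ! j)" "fst (h ! j) \<subseteq> available (take j h)"
    "fst (h ! j) \<subseteq> {..<j}" "snd (h ! j) \<subseteq> {..<j}" "card (fst (h ! j)) \<le> t"
proof -
  have "play t k (take j h @ [h ! j])"
    using play_take[OF assms(1), of "Suc j"] assms(2) by (simp add: take_Suc_conv_app_nth)
  moreover from this have "available (take j h) \<subseteq> {..<length (take j h)}"
    using available_less[of t k "take j h"] by (simp add: play_snoc_iff)
  ultimately show "snd (h ! j) \<subseteq> fst (h ! j)" "fst (h ! j) \<subseteq> available (take j h)"
    "fst (h ! j) \<subseteq> {..<j}" "snd (h ! j) \<subseteq> {..<j}" "card (fst (h ! j)) \<le> t"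
    using assms(2) by (auto simp: play_snoc_iff)
qed

text \<open>Move \<open>j\<close> was legal after the first \<open>j\<close> moves, and its
  neighbours all precede \<open>j\<close>, so later moves do not affect their cliques. The summand 2
  leaves at most \<open>k - 1\<close> vertices once \<open>j\<close> is added to
  \<open>K\<close>.\<close>

lemma play_clique:
  assumes "play t k h" "j < length h" "K \<subseteq> snd (h ! j)" "clique h K"
  shows "card K + 2 \<le> k"
proof -
  have "play t k (take j h @ [h ! j])"
    using play_take[OF assms(1), of "Suc j"] assms(2) by (simp add: take_Suc_conv_app_nth)
  moreover have "clique (take j h) K"
    using assms play_nth(4)[OF assms(1,2)] by (fastforce simp: clique_def)
  ultimately show ?thesis using assms(3) by (auto simp: play_snoc_iff)
qed

lemma clique_append:
  "K \<subseteq> {..<length h} \<Longrightarrow> clique (h @ h') K \<longleftrightarrow> clique h K"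
  by (fastforce simp: clique_def nth_append)

lemma indep_set_subset: "indep_set h S \<Longrightarrow> S' \<subseteq> S \<Longrightarrow> indep_set h S'"
  by (auto simp: indep_set_def)

lemma card_clique_indep_set:
  assumes "clique h K" "indep_set h K" "finite K"
  shows "card K \<le> 1"
proof -
  have "i = j" if "i \<in> K" "j \<in> K" for i j
    using assms that by (cases i j rule: linorder_cases) (auto simp: clique_def indep_set_def)
  then show ?thesis using assms(3) by (auto simp: card_le_Suc0_iff_eq)
qed

text \<open>The budget of the strategy: a move joined to a set with bound \<open>a\<close> is legal
  if \<open>a + 2 \<le> k\<close>, and adding an independent set to a common neighbourhood costs one
  unit.\<close>

definition clique_bound :: "move list \<Rightarrow> nat set \<Rightarrow> nat \<Rightarrow> bool" where
  "clique_bound h A a \<longleftrightarrow> (\<forall>K\<subseteq>A. clique h K \<longrightarrow> card K \<le> a)"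

lemma clique_bound_append:
  "A \<subseteq> {..<length h} \<Longrightarrow> clique_bound (h @ h') A a \<longleftrightarrow> clique_bound h A a"
  by (metis clique_append clique_bound_def subset_trans)

lemma clique_bound_Un_indep_set:
  assumes "clique_bound h A a" "indep_set h S" "finite S"
  shows "clique_bound h (A \<union> S) (Suc a)"
  unfolding clique_bound_def
proof (intro allI impI)
  fix K assume K: "K \<subseteq> A \<union> S" "clique h K"
  have "card (K \<inter> A) \<le> a" using assms(1) K by (auto simp: clique_bound_def clique_def)
  moreover have "card (K \<inter> S) \<le> 1"
    using assms K by (intro card_clique_indep_set) (auto simp: clique_def indep_set_def)
  moreover have "K = (K \<inter> A) \<union> (K \<inter> S)" using K by auto
  ultimately show "card K \<le> Suc a" using card_Un_le[of "K \<inter> A" "K \<inter> S"] by simp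
qed

text \<open>Colourer sees only the play up to the moment vertex \<open>i\<close> is presented. Hence
  the colour of a vertex survives every extension of the play.\<close>

definition colour :: "(move list \<Rightarrow> 'c) \<Rightarrow> move list \<Rightarrow> nat \<Rightarrow> 'c" where
  "colour c h i = c (take (Suc i) h)"

lemma colour_append: "i < length h \<Longrightarrow> colour c (h @ h') i = colour c h i"
  by (simp add: colour_def)

lemma colour_prefix_image:
  "prefix h h' \<Longrightarrow> X \<subseteq> {..<length h} \<Longrightarrow> colour c h' ` X = colour c h ` X"
  by (intro image_cong) (auto simp: prefix_def colour_append)

lemma colour_prefix_inj_on:
  "prefix h h' \<Longrightarrow> X \<subseteq> {..<length h} \<Longrightarrow> inj_on (colour c h') X \<longleftrightarrow> inj_on (colour c h) X"
  by (intro inj_on_cong) (auto simp: prefix_def colour_append)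

section \<open>Presenter's strategy against a fixed Colourer\<close>

locale coloured_plays =
  fixes t k L :: nat and c :: "move list \<Rightarrow> 'c"
  assumes proper: "play t k h \<Longrightarrow> h \<noteq> [] \<Longrightarrow> length h \<le> L \<Longrightarrow> i \<in> snd (last h) \<Longrightarrow>
    c (take (Suc i) h) \<noteq> c h"
begin

lemma move:
  assumes h: "play t k h" "length h < L" and B: "N \<subseteq> B" "B \<subseteq> available h" "card B \<le> t"
    and N: "clique_bound h N a" "a + 2 \<le> k"
  defines "h' \<equiv> h @ [(B, N)]"
  shows "play t k h'" "colour c h' (length h) \<notin> colour c h ` N"
proof -
  show *: "play t k h'"
    unfolding h'_def using assms by (intro play.snoc) (auto simp: clique_bound_def)
  show "colour c h' (length h) \<notin> colour c h ` N"
  proof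
    assume "colour c h' (length h) \<in> colour c h ` N"
    then obtain i where i: "i \<in> N" "colour c h' (length h) = colour c h i" by auto
    have "i < length h" using i B available_less[OF h(1)] by auto
    then have "c (take (Suc i) h') = c h'"
      using i(2) by (simp add: colour_def h'_def)
    then show False
      using proper[OF *, of i] i(1) h(2) by (simp add: h'_def)
  qed
qed

text \<open>
  \<open>U \<union> W\<close> is an independent set with distinct colours, and the colours of \<open>U\<close> reappear on \<open>V\<close>.  A new
  vertex adjacent to \<open>U\<close> only extends \<open>V \<union> W\<close>, unless its colour is that of some \<open>w \<in> W\<close>; then \<open>w\<close>
  moves to \<open>U\<close> and the new vertex joins \<open>V\<close>.
\<close>

lemma grow_by_swapping:
  assumes "play t k h" "A \<union> U \<union> V \<union> W \<subseteq> available h"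
    and "indep_set h (U \<union> W)" "indep_set h (V \<union> W)"
    and "inj_on (colour c h) (U \<union> W)" "inj_on (colour c h) (V \<union> W)"
    and "colour c h ` V = colour c h ` U" "U \<inter> W = {}" "U \<inter> V = {}"
    and "colour c h ` (U \<union> W) \<inter> colour c h ` A = {}"
    and "card A + 2 * (card U + card W) \<le> t" "length h + card W < L"
    and "clique_bound h A a" "a + 3 \<le> k"
  shows "\<exists>h' S. prefix h h' \<and> play t k h' \<and> length h' \<le> length h + card W + 1 \<and>
    A \<union> S \<subseteq> available h' \<and> indep_set h' S \<and> inj_on (colour c h') S \<and>
    card S = Suc (card U + card W) \<and> colour c h' ` S \<inter> colour c h' ` A = {}"
  using assms
proof (induction "card W" arbitrary: h U V W rule: less_induct)
  case (less W h U V)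
  let ?n = "length h" and ?B = "A \<union> U \<union> V \<union> W"
  \<comment> \<open>The whole bag is kept. Joining to \<open>U\<close> as well as \<open>A\<close>
    is affordable, as \<open>U\<close> is independent and \<open>a + 3 \<le> k\<close>.\<close>
  define h1 where "h1 = h @ [(?B, A \<union> U)]"
  have B: "?B \<subseteq> {..<?n}" using less.prems(1,2) available_less by blast
  then have fin: "finite A" "finite U" "finite V" "finite W"
    by (auto intro: finite_subset)
  have inj: "inj_on (colour c h) U" "inj_on (colour c h) V" "inj_on (colour c h) W"
    using less.prems(5,6) by (auto intro: inj_on_subset)
  \<comment> \<open>Both sets are injectively coloured with the same colours. So the bag has at most
    \<open>card A + 2 * card U + card W\<close> elements, which fits into \<open>t\<close>.\<close>
  have "card V = card U"
    using less.prems(7) inj(1,2) by (metis card_image)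
  have "card ?B \<le> card A + card U + card V + card W"
    using card_Un_le[of A U] card_Un_le[of "A \<union> U" V] card_Un_le[of "A \<union> U \<union> V" W] by linarith
  then have "card ?B \<le> t" using less.prems(11) \<open>card V = card U\<close> by simp
  moreover have "clique_bound h (A \<union> U) (Suc a)"
    using less.prems(3,13) fin by (intro clique_bound_Un_indep_set) (auto simp: indep_set_def)
  ultimately have h1: "play t k h1" "colour c h1 ?n \<notin> colour c h ` (A \<union> U)"
    unfolding h1_def using less.prems(1,2,12,14) by (intro move[where a = "Suc a"]; auto)+
  have pre: "prefix h h1" "length h1 = Suc ?n" by (auto simp: h1_def)
  have av: "available h1 = insert ?n ?B" by (simp add: h1_def)
  have col: "colour c h1 i = colour c h i" if "i \<in> ?B" for i
    using that B by (auto simp: h1_def colour_append)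
  have colim: "colour c h1 ` X = colour c h ` X" if "X \<subseteq> ?B" for X
    using that B pre by (intro colour_prefix_image) auto
  have colinj: "inj_on (colour c h1) X \<longleftrightarrow> inj_on (colour c h) X" if "X \<subseteq> ?B" for X
    using that B pre by (intro colour_prefix_inj_on) auto
  have nbrs: "snd (h1 ! i) = snd (h ! i)" "snd (h ! i) \<subseteq> {..<?n}" if "i \<in> ?B" for i
  proof -
    have "i < ?n" using that B by auto
    then show "snd (h1 ! i) = snd (h ! i)" "snd (h ! i) \<subseteq> {..<?n}"
      using play_nth(4)[OF less.prems(1), of i] by (auto simp: h1_def nth_append)
  qed
  have nbrs_n: "snd (h1 ! ?n) = A \<union> U" by (simp add: h1_def)
  have n: "?n \<notin> ?B" using B by auto
  \<comment> \<open>Disjointness is read off the colours: \<open>V\<close> shares those of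
    \<open>U\<close>, which differ from those of \<open>W\<close> and of \<open>A\<close>.\<close>
  have disj: "(V \<union> W) \<inter> (A \<union> U) = {}" "V \<inter> W = {}"
  proof -
    have "V \<inter> A = {}" "W \<inter> A = {}"
      using less.prems(7,10) by blast+
    then show "(V \<union> W) \<inter> (A \<union> U) = {}" using less.prems(8,9) by blast
    have "colour c h ` U \<inter> colour c h ` W = {}"
      using less.prems(5,8) by (subst inj_on_image_Int[symmetric]) auto
    then show "V \<inter> W = {}" using less.prems(7) by blast
  qed
  have ind: "indep_set h1 (insert ?n (V \<union> W))"
    unfolding indep_set_def
  proof (intro ballI)
    fix i j assume ij: "i \<in> insert ?n (V \<union> W)" "j \<in> insert ?n (V \<union> W)"
    show "i \<notin> snd (h1 ! j)"
    proof (cases "j = ?n")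
      case True
      then show ?thesis using ij(1) n disj(1) by (auto simp: nbrs_n)
    next
      case False
      then have j: "j \<in> V \<union> W" using ij by simp
      then show ?thesis
        using ij(1) nbrs[of j] less.prems(4) by (auto simp: indep_set_def)
    qed
  qed
  have clq: "clique_bound h1 A a"
    using less.prems(13) B by (simp add: h1_def clique_bound_append)
  show ?case
  proof (cases "colour c h1 ?n \<in> colour c h ` W")
    case False
    \<comment> \<open>The new colour avoids \<open>A\<close> and \<open>U\<close> by adjacency,
      \<open>V\<close> because it has the colours of \<open>U\<close>, and \<open>W\<close> by the
      case assumption.\<close>
    let ?S = "insert ?n (V \<union> W)"
    have new: "colour c h1 ?n \<notin> colour c h ` ?B"
      using h1(2) less.prems(7) False by (auto simp: image_Un)
    have VW: "colour c h1 ` (V \<union> W) = colour c h ` (V \<union> W)" "inj_on (colour c h1) (V \<union> W)"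
      using less.prems(6) by (subst colim colinj; auto)+
    have "A \<union> ?S \<subseteq> available h1" unfolding av by auto
    moreover have "colour c h1 ?n \<notin> colour c h1 ` (V \<union> W - {?n})" using VW(1) new by auto
    then have "inj_on (colour c h1) ?S" using VW(2) by (simp only: inj_on_insert) simp
    moreover have "card ?S = Suc (card U + card W)"
      using n fin disj(2) \<open>card V = card U\<close> by (simp add: card_Un_disjoint)
    moreover have "colour c h1 ` A = colour c h ` A" by (rule colim) auto
    then have "colour c h1 ` ?S \<inter> colour c h1 ` A = {}"
      using new less.prems(7,10) VW(1) by (auto simp: image_Un)
    ultimately show ?thesis
      using ind h1(1) pre by (intro exI[of _ h1] exI[of _ ?S]) auto
  next
    case True
    then obtain w where w: "w \<in> W" "colour c h1 ?n = colour c h w" by auto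
    \<comment> \<open>The swap leaves \<open>card U + card W\<close> unchanged, so the bag bound
      persists, while the loss of one element of \<open>W\<close> pays for the move. With
      \<open>W\<close> empty this case cannot arise.\<close>
    let ?U = "insert w U" and ?V = "insert ?n V" and ?W = "W - {w}"
    have UW: "?U \<union> ?W = U \<union> W" using w by auto
    have "w \<notin> U" "w \<notin> V" using w less.prems(8) disj(2) by auto
    have cardW: "card W = Suc (card ?W)" using w fin by (metis card_Suc_Diff1)
    have cardU: "card ?U = Suc (card U)" using fin \<open>w \<notin> U\<close> by simp
    have "\<exists>h' S. prefix h1 h' \<and> play t k h' \<and> length h' \<le> length h1 + card ?W + 1 \<and>
      A \<union> S \<subseteq> available h' \<and> indep_set h' S \<and> inj_on (colour c h') S \<and>
      card S = Suc (card ?U + card ?W) \<and> colour c h' ` S \<inter> colour c h' ` A = {}"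
    proof (rule less.hyps)
      show "card ?W < card W" using cardW by simp
      show "A \<union> ?U \<union> ?V \<union> ?W \<subseteq> available h1" using w unfolding av by auto
      show "indep_set h1 (?U \<union> ?W)"
        using less.prems(3) nbrs(1) unfolding UW by (auto simp: indep_set_def)
      show "indep_set h1 (?V \<union> ?W)" by (rule indep_set_subset[OF ind]) auto
      show "inj_on (colour c h1) (?U \<union> ?W)"
        unfolding UW using less.prems(5) by (subst colinj) auto
      have "colour c h w \<notin> colour c h ` (V \<union> ?W)"
        using less.prems(6) w \<open>w \<notin> V\<close> by (auto simp: inj_on_def)
      moreover have "?V \<union> ?W = insert ?n (V \<union> ?W)" by auto
      moreover have "inj_on (colour c h1) (V \<union> ?W)"
        using less.prems(6) by (subst colinj) (auto intro: inj_on_subset)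
      moreover have "colour c h1 ` (V \<union> ?W) = colour c h ` (V \<union> ?W)" by (rule colim) auto
      ultimately show "inj_on (colour c h1) (?V \<union> ?W)"
        using w(2) by (simp only: inj_on_insert) auto
      have "colour c h1 ` U = colour c h ` U" "colour c h1 ` V = colour c h ` V"
        by (rule colim; auto)+
      then show "colour c h1 ` ?V = colour c h1 ` ?U"
        using w col[of w] less.prems(7) by simp
      show "?U \<inter> ?W = {}" using less.prems(8) by auto
      show "?U \<inter> ?V = {}" using less.prems(9) n w \<open>w \<notin> V\<close> by auto
      show "colour c h1 ` (?U \<union> ?W) \<inter> colour c h1 ` A = {}"
        unfolding UW using less.prems(10) by (subst (1 2) colim) auto
      show "card A + 2 * (card ?U + card ?W) \<le> t" using cardW cardU less.prems(11) by simp
      show "length h1 + card ?W < L" using cardW pre less.prems(12) by simp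
    qed (use h1 clq less.prems in auto)
    then obtain h' S where "prefix h1 h'" "play t k h'" "length h' \<le> length h1 + card ?W + 1"
      "A \<union> S \<subseteq> available h'" "indep_set h' S" "inj_on (colour c h') S"
      "card S = Suc (card ?U + card ?W)" "colour c h' ` S \<inter> colour c h' ` A = {}"
      by blast
    then show ?thesis
      using cardW cardU pre prefix_order.trans[OF pre(1)]
      by (intro exI[of _ h'] exI[of _ S]) auto
  qed
qed

text \<open>Each enlargement runs the swapping argument from \<open>U = V = {}\<close> and
  \<open>W = S\<close>, costing at most \<open>card S + 1\<close> moves; \<open>s * s\<close>
  generously bounds their sum. The last enlargement starts from \<open>s - 1\<close> vertices,
  whence the room \<open>2 * (s - 1)\<close>.\<close>

lemma grow:
  assumes "play t k h" "A \<subseteq> available h" "clique_bound h A a" "a + 3 \<le> k"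
    and "card A + 2 * (s - 1) \<le> t" "length h + s * s \<le> L"
  shows "\<exists>h' S. prefix h h' \<and> play t k h' \<and> length h' \<le> length h + s * s \<and>
    A \<union> S \<subseteq> available h' \<and> indep_set h' S \<and> inj_on (colour c h') S \<and>
    card S = s \<and> colour c h' ` S \<inter> colour c h' ` A = {}"
  using assms(5,6)
proof (induction s)
  case 0
  show ?case
    by (rule exI[of _ h], rule exI[of _ "{}"]) (use assms in \<open>auto simp: indep_set_def\<close>)
next
  case (Suc s)
  have "card A + 2 * (s - 1) \<le> t" "length h + s * s \<le> L" using Suc.prems by simp_all
  from Suc.IH[OF this] obtain h1 S where
    h1: "prefix h h1" "play t k h1" "length h1 \<le> length h + s * s"
    and S: "A \<union> S \<subseteq> available h1" "indep_set h1 S" "inj_on (colour c h1) S"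
      "card S = s" "colour c h1 ` S \<inter> colour c h1 ` A = {}"
    by auto
  have "clique_bound h1 A a"
    using assms h1(1) available_less[OF assms(1)] by (auto simp: prefix_def clique_bound_append)
  then have "\<exists>h' S'. prefix h1 h' \<and> play t k h' \<and> length h' \<le> length h1 + card S + 1 \<and>
    A \<union> S' \<subseteq> available h' \<and> indep_set h' S' \<and> inj_on (colour c h') S' \<and>
    card S' = Suc (card ({} :: nat set) + card S) \<and> colour c h' ` S' \<inter> colour c h' ` A = {}"
    using h1 S Suc.prems assms(4) by (intro grow_by_swapping[where V = "{}"]) auto
  then obtain h' S' where h': "prefix h1 h'" "play t k h'" "length h' \<le> length h1 + card S + 1"
    and S': "A \<union> S' \<subseteq> available h'" "indep_set h' S'" "inj_on (colour c h') S'"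
      "card S' = Suc (card S)" "colour c h' ` S' \<inter> colour c h' ` A = {}"
    by auto
  have "prefix h h'" using h1(1) h'(1) by (rule prefix_order.trans)
  moreover have "length h' \<le> length h + Suc s * Suc s" using h1(3) h'(3) S(4) by simp
  ultimately show ?case using h' S' S(4) by auto
qed

lemma g_rec:
  assumes "s \<noteq> 0" "q \<ge> 3"
  shows "g s q = Suc (s div 2) + g ((s - 1) div 2) (q - 1)"
proof -
  have "\<lceil>(real s + 1) / 2\<rceil> = int (Suc (s div 2))"
    by (cases "even s") (auto elim!: evenE oddE intro!: ceiling_unique)
  moreover have "\<lfloor>(real s - 1) / 2\<rfloor> = int ((s - 1) div 2)"
    using assms by (cases "even (s - 1)"; cases s) (auto elim!: evenE oddE intro!: floor_unique)
  ultimately show ?thesis using assms by (subst g.simps) simp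
qed

text \<open>Here \<open>A\<close> is the set to which all further vertices are joined,
  \<open>s\<close> the room left in the bag and \<open>q\<close> the remaining clique budget.
  Colours on \<open>A\<close> are not counted, so the recursive call for \<open>A \<union> S\<close>
  contributes colours different from those of \<open>S\<close>.\<close>

lemma many_colours:
  assumes "play t k h" "A \<subseteq> available h" "card A + s \<le> t" "clique_bound h A a" "a + q \<le> k" "2 \<le> q"
    and "length h + (s + 1) ^ 3 \<le> L"
  shows "\<exists>h'. prefix h h' \<and> play t k h' \<and> length h' \<le> L \<and>
    g s q \<le> card (colour c h' ` {..<length h'} - colour c h' ` A)"
  using assms
proof (induction s arbitrary: q h A a rule: less_induct)
  case (less s)
  have A: "A \<subseteq> {..<length h}" using less.prems available_less by blast
  show ?case
  proof (cases "s = 0 \<or> q = 2")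
    case True
    \<comment> \<open>One vertex joined to all of \<open>A\<close> has a colour not on
      \<open>A\<close>, and here only one colour is demanded.\<close>
    define h' where "h' = h @ [(A, A)]"
    have "length h < L" using less.prems(7) by (simp add: power3_eq_cube)
    then have *: "play t k h'" "colour c h' (length h) \<notin> colour c h ` A"
      unfolding h'_def using less.prems by (intro move[where a = a]; simp)+
    have "colour c h' ` A = colour c h ` A"
      using A by (intro colour_prefix_image) (auto simp: h'_def)
    then have "colour c h' (length h) \<in> colour c h' ` {..<length h'} - colour c h' ` A"
      using * by (auto simp: h'_def)
    then have "0 < card (colour c h' ` {..<length h'} - colour c h' ` A)"
      by (auto simp: card_gt_0_iff)
    moreover have "g s q = 1" using True less.prems(6) by (auto simp: g.simps)
    ultimately show ?thesis using * \<open>length h < L\<close>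
      by (intro exI[of _ h']) (auto simp: h'_def)
  next
    case False
    then have q: "q \<ge> 3" and s: "s \<noteq> 0" using less.prems by auto
    \<comment> \<open>This \<open>m\<close> is the largest size that \<open>grow\<close> can reach
      in room \<open>s\<close>, as \<open>2 * (m - 1) \<le> s\<close>; once the \<open>m\<close>
      vertices are kept, exactly \<open>s'\<close> places remain.\<close>
    define m where "m = Suc (s div 2)"
    define s' where "s' = (s - 1) div 2"
    have ms: "m + s' = s" "m \<le> s + 1" "s' + 1 \<le> s" "s' < s" using s by (auto simp: m_def s'_def)
    have "m * m \<le> (s + 1) * (s + 1)" using ms by (intro mult_mono) auto
    moreover have "(s' + 1) ^ 3 \<le> s ^ 3" using ms by (intro power_mono) auto
    moreover have "(s + 1) * (s + 1) + s ^ 3 \<le> (s + 1) ^ 3"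
      by (simp add: power3_eq_cube algebra_simps)
    \<comment> \<open>The cubic budget covers the moves of \<open>grow\<close> together with those
      of the recursive call.\<close>
    ultimately have bound: "m * m + (s' + 1) ^ 3 \<le> (s + 1) ^ 3" by linarith
    have "card A + 2 * (m - 1) \<le> t" using less.prems(3) by (simp add: m_def)
    with less.prems q bound obtain h1 S where h1: "prefix h h1" "play t k h1"
        "length h1 \<le> length h + m * m"
      and S: "A \<union> S \<subseteq> available h1" "indep_set h1 S" "inj_on (colour c h1) S"
        "card S = m" "colour c h1 ` S \<inter> colour c h1 ` A = {}"
      using grow[of h A a m] by auto
    have lt: "A \<union> S \<subseteq> {..<length h1}" using S(1) available_less[OF h1(2)] by blast
    then have "finite S" using finite_subset by blast
    have "\<exists>h'. prefix h1 h' \<and> play t k h' \<and> length h' \<le> L \<and>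
      g s' (q - 1) \<le> card (colour c h' ` {..<length h'} - colour c h' ` (A \<union> S))"
    proof (rule less.IH)
      show "card (A \<union> S) + s' \<le> t"
        using card_Un_le[of A S] S(4) ms less.prems(3) by linarith
      have "clique_bound h1 A a"
        using less.prems h1(1) A by (auto simp: prefix_def clique_bound_append)
      then show "clique_bound h1 (A \<union> S) (Suc a)"
        using S \<open>finite S\<close> by (intro clique_bound_Un_indep_set)
      show "length h1 + (s' + 1) ^ 3 \<le> L" using h1(3) bound less.prems(7) by linarith
    qed (use h1 S ms q less.prems in auto)
    then obtain h' where h': "prefix h1 h'" "play t k h'" "length h' \<le> L"
      "g s' (q - 1) \<le> card (colour c h' ` {..<length h'} - colour c h' ` (A \<union> S))"
      by auto
    let ?C = "colour c h' ` {..<length h'} - colour c h' ` (A \<union> S)"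
    have eq: "colour c h' ` X = colour c h1 ` X" if "X \<subseteq> A \<union> S" for X
      using that lt h'(1) by (intro colour_prefix_image) auto
    have "length h1 \<le> length h'" using h'(1) by (rule prefix_length_le)
    then have "colour c h' ` S \<subseteq> colour c h' ` {..<length h'}" using lt by (intro image_mono) auto
    then have "?C \<union> colour c h' ` S \<subseteq> colour c h' ` {..<length h'} - colour c h' ` A"
      using eq[of S] eq[of A] S(5) by auto
    then have "card (?C \<union> colour c h' ` S) \<le> card (colour c h' ` {..<length h'} - colour c h' ` A)"
      by (intro card_mono) auto
    moreover have "card (?C \<union> colour c h' ` S) = card ?C + card (colour c h' ` S)"
      using \<open>finite S\<close> by (intro card_Un_disjoint) auto
    moreover have "card (colour c h' ` S) = m"
      using eq[of S] S(3,4) by (simp add: card_image)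
    moreover have "g s q = m + g s' (q - 1)" using g_rec[OF s q] by (simp add: m_def s'_def)
    ultimately show ?thesis using h' h1(1) prefix_order.trans[OF h1(1) h'(1)]
      by (intro exI[of _ h']) auto
  qed
qed

end

section \<open>The graph of all plays\<close>

text \<open>A non-empty play stands for the vertex presented by its last move.\<close>

definition positions :: "nat \<Rightarrow> nat \<Rightarrow> nat \<Rightarrow> move list set" where
  "positions t k L = {h. play t k h \<and> h \<noteq> [] \<and> length h \<le> L}"

text \<open>Index \<open>i\<close> in \<open>h\<close> turns into the prefix that ends by presenting
  vertex \<open>i\<close>, so plays with this common prefix refer to the same vertex.\<close>

definition position_bag :: "move list \<Rightarrow> move list set" where
  "position_bag h = insert h ((\<lambda>i. take (Suc i) h) ` fst (last h))"

definition earlier_nbrs :: "move list \<Rightarrow> move list set" where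
  "earlier_nbrs h = (\<lambda>i. take (Suc i) h) ` snd (last h)"

lemma play_last:
  assumes "play t k h" "h \<noteq> []"
  shows "snd (last h) \<subseteq> fst (last h)" "fst (last h) \<subseteq> {..<length h - 1}"
    "fst (last h) \<subseteq> available (butlast h)" "card (fst (last h)) \<le> t"
  using play_nth[OF assms(1), of "length h - 1"] assms(2)
  by (simp_all add: last_conv_nth butlast_conv_take)

lemma finite_positions: "finite (positions t k L)"
proof (rule finite_subset)
  show "positions t k L \<subseteq> {h. set h \<subseteq> Pow {..<L} \<times> Pow {..<L} \<and> length h \<le> L}"
  proof
    fix h assume h: "h \<in> positions t k L"
    have "h ! j \<in> Pow {..<L} \<times> Pow {..<L}" if "j < length h" for j
      using play_nth(3,4)[of t k h j] h that by (cases "h ! j") (force simp: positions_def)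
    then have "set h \<subseteq> Pow {..<L} \<times> Pow {..<L}" by (metis in_set_conv_nth subsetI)
    then show "h \<in> {h. set h \<subseteq> Pow {..<L} \<times> Pow {..<L} \<and> length h \<le> L}"
      using h by (simp add: positions_def)
  qed
qed (simp add: finite_lists_length_le)

lemma take_in_positions:
  "h \<in> positions t k L \<Longrightarrow> take (Suc i) h \<in> positions t k L"
  by (auto simp: positions_def play_take)

lemma position_bag_subset: "h \<in> positions t k L \<Longrightarrow> position_bag h \<subseteq> positions t k L"
  by (auto simp: position_bag_def take_in_positions)

lemma card_position_bag:
  assumes "h \<in> positions t k L"
  shows "card (position_bag h) \<le> Suc t"
proof -
  have h: "play t k h" "h \<noteq> []" using assms by (auto simp: positions_def)
  have "finite (fst (last h))" using play_last(2)[OF h] finite_subset by blast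
  then have "card ((\<lambda>i. take (Suc i) h) ` fst (last h)) \<le> t"
    using card_image_le[of "fst (last h)" "\<lambda>i. take (Suc i) h"] play_last(4)[OF h] by linarith
  then show ?thesis
    unfolding position_bag_def
    using card_insert_le_m1[of "Suc t"] by simp
qed

lemma earlier_nbrs_subset: "h \<in> positions t k L \<Longrightarrow> earlier_nbrs h \<subseteq> position_bag h"
  using play_last(1) by (force simp: positions_def earlier_nbrs_def position_bag_def)

lemma earlier_nbrsD:
  assumes "y \<in> positions t k L" "x \<in> earlier_nbrs y"
  shows "length x - 1 \<in> snd (last y)" "x = take (length x) y" "length x < length y" "x \<noteq> []"
proof -
  have y: "play t k y" "y \<noteq> []" using assms by (auto simp: positions_def)
  obtain i where i: "i \<in> snd (last y)" "x = take (Suc i) y"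
    using assms(2) by (auto simp: earlier_nbrs_def)
  then have "i < length y - 1" using play_last[OF y] by auto
  with i y show "length x - 1 \<in> snd (last y)" "x = take (length x) y" "length x < length y" "x \<noteq> []"
    by auto
qed

text \<open>What the last move keeps was available just before it, and that is the bag of
  \<open>butlast y\<close>. This is the condition for a tree decomposition in which the parent of a
  play is its \<open>butlast\<close>.\<close>

lemma position_bag_step:
  assumes y: "y \<in> positions t k L" and x: "x \<in> position_bag y" "x \<noteq> y"
  shows "length y > 1" "x \<in> position_bag (butlast y)"
proof -
  have y: "play t k y" "y \<noteq> []" using y by (auto simp: positions_def)
  obtain i where i: "i \<in> fst (last y)" "x = take (Suc i) y"
    using x by (auto simp: position_bag_def)
  then have lt: "i < length y - 1" using play_last[OF y] by auto
  then show "length y > 1" by simp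
  have x: "x = take (Suc i) (butlast y)" using i lt by (simp add: take_butlast)
  have "i \<in> available (butlast y)" using i play_last(3)[OF y] by auto
  then consider "i = length (butlast y) - 1" | "i \<in> fst (last (butlast y))"
    by (auto simp: available_def split: if_splits)
  then show "x \<in> position_bag (butlast y)"
  proof cases
    case 1
    then have "x = butlast y" using x lt by simp
    then show ?thesis by (simp add: position_bag_def)
  next
    case 2
    then show ?thesis using x by (simp add: position_bag_def)
  qed
qed

text \<open>Nothing is available for the first move, so the tree of plays has a single root.\<close>

lemma positions_root:
  assumes "y \<in> positions t k L"
  shows "length y = 1 \<longleftrightarrow> y = [({}, {})]"
proof
  assume "length y = 1"
  then obtain m where "y = [m]" by (auto simp: length_Suc_conv)
  then show "y = [({}, {})]"
    using assms play_snoc_iff[of t k "[]" m]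
    by (cases m) (auto simp: positions_def available_def)
qed simp

text \<open>All members of a clique are prefixes of its longest play \<open>y\<close>. The clique
  can therefore be read inside the single play \<open>y\<close>, where the other members form a
  clique among the neighbours of the last vertex.\<close>

lemma card_clique_positions:
  assumes K: "K \<subseteq> positions t k L" and "2 \<le> k"
    and adj: "\<And>x y. x \<in> K \<Longrightarrow> y \<in> K \<Longrightarrow> x \<noteq> y \<Longrightarrow> x \<in> earlier_nbrs y \<or> y \<in> earlier_nbrs x"
  shows "card K < k"
proof (cases "K = {}")
  case False
  have fin: "finite K" using K finite_positions finite_subset by blast
  then have "Max (length ` K) \<in> length ` K" using False by (intro Max_in) auto
  then obtain y where "y \<in> K" "length y = Max (length ` K)" by auto
  then have y: "y \<in> K" "\<And>x. x \<in> K \<Longrightarrow> length x \<le> length y" using fin by auto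
  \<comment> \<open>Earlier neighbours are strictly shorter, so maximality of \<open>y\<close> fixes
    the direction of adjacency.\<close>
  have nbr: "x \<in> earlier_nbrs y" if "x \<in> K - {y}" for x
    using adj[of x y] y that earlier_nbrsD(3)[of x t k L y] K by force
  have yP: "play t k y" "y \<noteq> []" using y K by (auto simp: positions_def)
  note D = earlier_nbrsD[OF subsetD[OF K y(1)] nbr]
  let ?I = "(\<lambda>x. length x - 1) ` (K - {y})"
  have "inj_on (\<lambda>x. length x - 1) (K - {y})"
  proof (rule inj_onI)
    fix x z assume xz: "x \<in> K - {y}" "z \<in> K - {y}" and "length x - 1 = length z - 1"
    then have "length x = length z" using D(4) by (metis One_nat_def Suc_pred length_greater_0_conv)
    then show "x = z" using D(2) xz by metis
  qed
  then have "card ?I = card K - 1"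
    using y(1) by (simp add: card_image)
  moreover have "clique y ?I"
    unfolding clique_def
  proof (intro ballI impI)
    fix i j assume "i \<in> ?I" "j \<in> ?I" and less: "i < j"
    then obtain x z where xz: "x \<in> K - {y}" "z \<in> K - {y}" "i = length x - 1" "j = length z - 1"
      by auto
    then have "x \<notin> earlier_nbrs z \<Longrightarrow> False"
      using adj[of x z] less earlier_nbrsD(3)[of x t k L z] K by force
    then have "i \<in> snd (last z)" using xz earlier_nbrsD(1)[of z t k L x] K by auto
    \<comment> \<open>The play \<open>z\<close> is the prefix of \<open>y\<close> of length
      \<open>j + 1\<close>.\<close>
    moreover have "last z = y ! j"
      using D(2,3,4)[OF xz(2)] xz(4) by (metis last_conv_nth nth_take diff_less length_greater_0_conv zero_less_one)
    ultimately show "i \<in> snd (y ! j)" by simp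
  qed
  moreover have "?I \<subseteq> snd (y ! (length y - 1))"
    using D(1) yP by (auto simp: last_conv_nth)
  ultimately have "card K - 1 + 2 \<le> k"
    using play_clique[OF yP(1), of "length y - 1" ?I] yP(2) by simp
  then show ?thesis by linarith
qed (use \<open>2 \<le> k\<close> in simp)

section \<open>The graph of plays, its clique number, tree-width and chromatic number\<close>

locale encoded_positions =
  fixes t k L :: nat and e :: "move list \<Rightarrow> nat"
  assumes inj: "inj_on e (positions t k L)" and k: "2 \<le> k" and L: "1 \<le> L"
begin

abbreviation "V \<equiv> positions t k L"

text \<open>Plays are renamed by the injection \<open>e\<close> so that the same natural numbers can
  serve as vertices of the graph and as nodes of its decomposition tree.\<close>

definition position_graph :: "nat pair_pre_digraph" where
  "position_graph = \<lparr>pverts = e ` V,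
     parcs = {(e x, e y) |x y. x \<in> V \<and> y \<in> V \<and> (x \<in> earlier_nbrs y \<or> y \<in> earlier_nbrs x)}\<rparr>"

lemma pverts_position_graph [simp]: "pverts position_graph = e ` V"
  by (simp add: position_graph_def)

lemma parcs_position_graph_iff:
  assumes "x \<in> V" "y \<in> V"
  shows "(e x, e y) \<in> parcs position_graph \<longleftrightarrow> x \<in> earlier_nbrs y \<or> y \<in> earlier_nbrs x"
  using assms inj by (auto simp: position_graph_def dest: inj_onD)

lemma parcs_position_graphE:
  assumes "(u, v) \<in> parcs position_graph"
  obtains x y where "u = e x" "v = e y" "x \<in> V" "y \<in> V" "x \<in> earlier_nbrs y \<or> y \<in> earlier_nbrs x"
  using assms by (auto simp: position_graph_def)

lemma pair_graph_position_graph: "pair_graph position_graph"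
proof
  show "finite (pverts position_graph)" by (simp add: finite_positions)
  show "finite (parcs position_graph)"
    by (rule finite_subset[of _ "e ` V \<times> e ` V"]) (auto simp: position_graph_def finite_positions)
  show "symmetric (with_proj position_graph)"
    by (auto simp: symmetric_def sym_def position_graph_def)
next
  fix a assume a: "a \<in> parcs position_graph"
  then show "fst a \<in> pverts position_graph" "snd a \<in> pverts position_graph"
    by (auto simp: position_graph_def)
  obtain x y where xy: "a = (e x, e y)" "x \<in> V" "y \<in> V" "x \<in> earlier_nbrs y \<or> y \<in> earlier_nbrs x"
    using a by (auto simp: position_graph_def)
  then have "x \<noteq> y" using earlier_nbrsD(3) by blast
  then show "fst a \<noteq> snd a" using xy inj by (auto dest: inj_onD)
qed

lemma clique_free_position_graph: "clique_free k position_graph"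
  unfolding clique_free_def
proof
  assume "\<exists>H. subgraph H (with_proj position_graph) \<and> complete_digraph k H"
  then obtain H where H: "subgraph H (with_proj position_graph)" "complete_digraph k H" by auto
  define K where "K = {x \<in> V. e x \<in> verts H}"
  have "verts H \<subseteq> e ` V" using H(1) by (auto simp: subgraph_def)
  then have "verts H = e ` K" by (auto simp: K_def)
  moreover have "inj_on e K" using inj by (rule inj_on_subset) (auto simp: K_def)
  ultimately have "card K = k" using H(2) by (simp add: complete_digraph_def card_image)
  have "card K < k"
  proof (rule card_clique_positions)
    show "K \<subseteq> V" by (auto simp: K_def)
    fix x y assume xy: "x \<in> K" "y \<in> K" "x \<noteq> y"
    then have "e x \<noteq> e y" using \<open>inj_on e K\<close> by (auto dest: inj_onD)
    then have "(e x, e y) \<in> arcs_ends H"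
      using H(2) xy by (auto simp: complete_digraph_def K_def)
    then have "(e x, e y) \<in> parcs position_graph"
      using arcs_ends_mono[OF H(1)] by auto
    then show "x \<in> earlier_nbrs y \<or> y \<in> earlier_nbrs x"
      using xy by (simp add: parcs_position_graph_iff K_def)
  qed (rule k)
  then show False using \<open>card K = k\<close> by simp
qed

lemma treewidth_position_graph: "treewidth position_graph \<le> int t"
proof -
  define d where "d = inv_into V e"
  have d: "d (e x) = x" if "x \<in> V" for x using that inj by (simp add: d_def)
  define \<beta> where "\<beta> n = e ` position_bag (d n)" for n
  \<comment> \<open>Even the first move must pass the clique test for the empty set, which amounts
    to \<open>2 \<le> k\<close>.\<close>
  have root: "[({}, {})] \<in> V"
    using L k by (auto simp: positions_def available_def clique_def play_snoc_iff[of _ _ "[]", simplified] play.Nil)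
  have root_iff: "e x = e [({}, {})] \<longleftrightarrow> length x = 1" if "x \<in> V" for x
    using positions_root[OF that] inj that root by (auto dest: inj_onD)
  have butlast: "butlast x \<in> V" if "x \<in> V" "length x \<noteq> 1" for x
    using that by (cases x rule: rev_cases) (auto simp: positions_def play_snoc_iff)
  \<comment> \<open>The tree of plays: deleting the last move leads to the parent, and the length is
    the rank.\<close>
  interpret T: rooted_tree "e ` V" "e [({}, {})]" "\<lambda>n. e (butlast (d n))" "\<lambda>n. length (d n)"
  proof
    show "finite (e ` V)" by (simp add: finite_positions)
    show "e [({}, {})] \<in> e ` V" using root by simp
    fix n assume "n \<in> e ` V" "n \<noteq> e [({}, {})]"
    then obtain x where x: "x \<in> V" "n = e x" "length x \<noteq> 1" using root_iff by auto
    then show "e (butlast (d n)) \<in> e ` V" by (simp add: d butlast)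
    have "x \<noteq> []" using x(1) by (simp add: positions_def)
    then show "length (d (e (butlast (d n)))) < length (d n)" using x by (simp add: d butlast)
  qed
  have "tree_decomposition position_graph T.parent_tree \<beta>"
  proof (rule T.tree_decomposition_parent_tree)
    show "pverts position_graph = e ` V" by simp
    show "u \<in> e ` V \<and> v \<in> e ` V \<and> (u \<in> \<beta> v \<or> v \<in> \<beta> u)" if "(u, v) \<in> parcs position_graph" for u v
      using that earlier_nbrs_subset
      by (elim parcs_position_graphE) (fastforce simp: \<beta>_def d)
    show "n \<in> \<beta> n \<and> \<beta> n \<subseteq> e ` V" if "n \<in> e ` V" for n
      using that position_bag_subset by (fastforce simp: \<beta>_def d position_bag_def)
    show "n \<noteq> e [({}, {})] \<and> v \<in> \<beta> (e (butlast (d n)))"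
      if "n \<in> e ` V" "v \<in> \<beta> n" "n \<noteq> v" for n v
    proof -
      obtain y where y: "y \<in> V" "n = e y" using \<open>n \<in> e ` V\<close> by auto
      then obtain x where x: "x \<in> position_bag y" "v = e x"
        using \<open>v \<in> \<beta> n\<close> by (auto simp: \<beta>_def d)
      then have "length y > 1" "x \<in> position_bag (butlast y)"
        using position_bag_step[OF y(1) x(1)] y(2) \<open>n \<noteq> v\<close> by auto
      then show ?thesis
        using x y root_iff[of y] butlast[of y] by (auto simp: \<beta>_def d)
    qed
  qed
  then show ?thesis
  proof (rule treewidth_le)
    fix z assume "z \<in> pverts T.parent_tree"
    then obtain x where x: "x \<in> V" "z = e x" by auto
    have "finite (position_bag x)"
      using position_bag_subset[OF x(1)] finite_positions finite_subset by blast
    then have "card (\<beta> z) \<le> card (position_bag x)" using x by (simp add: \<beta>_def d card_image_le)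
    then show "card (\<beta> z) \<le> Suc t" using card_position_bag[OF x(1)] by linarith
  qed
qed

lemma chromatic_number_position_graph:
  assumes "(t + 1) ^ 3 \<le> L"
  shows "g t k \<le> chromatic_number position_graph"
proof -
  let ?P = "\<lambda>n. \<exists>c :: nat \<Rightarrow> nat. c ` pverts position_graph \<subseteq> {..<n} \<and>
    proper_colouring position_graph c"
  interpret G: pair_graph position_graph by (rule pair_graph_position_graph)
  \<comment> \<open>The identity shows that some finite number of colours suffices, so the
    \<open>LEAST\<close> is attained.\<close>
  have "proper_colouring position_graph id"
    using G.no_loops' by (auto simp: proper_colouring_def)
  moreover have "id ` pverts position_graph \<subseteq> {..<Suc (Max (pverts position_graph))}"
    using G.pair_finite_verts by (auto simp: less_Suc_eq_le)
  ultimately have "?P (Suc (Max (pverts position_graph)))" by blast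
  then have "?P (chromatic_number position_graph)"
    unfolding chromatic_number_def by (rule LeastI)
  then obtain c :: "nat \<Rightarrow> nat" where c: "c ` e ` V \<subseteq> {..<chromatic_number position_graph}"
    "proper_colouring position_graph c" by auto
  \<comment> \<open>An optimal proper colouring, read along plays, is a strategy for
    Colourer.\<close>
  interpret coloured_plays t k L "c \<circ> e"
  proof
    fix h i assume h: "play t k h" "h \<noteq> []" "length h \<le> L" and i: "i \<in> snd (last h)"
    then have V: "h \<in> V" "take (Suc i) h \<in> V" by (auto simp: positions_def play_take)
    have "take (Suc i) h \<in> earlier_nbrs h" using i by (auto simp: earlier_nbrs_def)
    then have "(e (take (Suc i) h), e h) \<in> parcs position_graph"
      using V by (simp add: parcs_position_graph_iff)
    then show "(c \<circ> e) (take (Suc i) h) \<noteq> (c \<circ> e) h"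
      using c(2) by (auto simp: proper_colouring_def)
  qed
  \<comment> \<open>Presenter starts from the empty play with an empty set \<open>A\<close>, full
    room \<open>t\<close> and full budget \<open>k\<close>; all colours of the resulting single play
    occur in the graph.\<close>
  have "\<exists>h'. prefix [] h' \<and> play t k h' \<and> length h' \<le> L \<and>
    g t k \<le> card (colour (c \<circ> e) h' ` {..<length h'} - colour (c \<circ> e) h' ` {})"
    using assms k
    by (intro many_colours[where a = 0]) (auto simp: play.Nil clique_bound_def)
  then obtain h where h: "play t k h" "length h \<le> L"
    "g t k \<le> card (colour (c \<circ> e) h ` {..<length h})" by auto
  have "take (Suc i) h \<in> V" if "i < length h" for i
    using that h by (auto simp: positions_def play_take)
  then have "colour (c \<circ> e) h ` {..<length h} \<subseteq> {..<chromatic_number position_graph}"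
    using c(1) by (auto simp: colour_def)
  then have "card (colour (c \<circ> e) h ` {..<length h}) \<le> chromatic_number position_graph"
    using card_mono[of "{..<chromatic_number position_graph}"] by fastforce
  then show ?thesis using h(3) by linarith
qed

end

theorem theorem2:
  fixes t k :: nat
  assumes "k \<ge> 2"
  shows "\<exists>G :: nat pair_pre_digraph. pair_graph G \<and> clique_free k G \<and>
           treewidth G \<le> int t \<and> chromatic_number G \<ge> g t k"
proof -
  \<comment> \<open>This is the number of moves that \<open>many_colours\<close> asks for with room
    \<open>t\<close>, starting from the empty play.\<close>
  let ?L = "(t + 1) ^ 3"
  obtain e :: "move list \<Rightarrow> nat" where "inj_on e (positions t k ?L)"
    using finite_imp_inj_to_nat_seg[OF finite_positions] by blast
  then interpret encoded_positions t k ?L e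
    using assms by unfold_locales auto
  show ?thesis
    using pair_graph_position_graph clique_free_position_graph treewidth_position_graph
      chromatic_number_position_graph by auto
qed

end
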